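(* Let $\mathbf{a}\in\mathbb{R}^{n_{\mathrm e}}_{\ge0}$, $\omega>0$, $\mathbf{Q}\in\mathbb{R}^{n_{\mathrm{dof}}\times q}$, $\overline{d}_{\mathrm R}>0$, and $c_1,c_2\in\mathbb{R}$ with $c_1^2+c_2^2=1$. Put $\mathbf{S}:=\mathbf{K}(\mathbf{a})-\omega^2\mathbf{M}(\mathbf{a})$. The following are equivalent: (1) $\mathbf{S}\succeq\mathbf{0}$, $\ \mathcal{R}(\mathbf{Q})\subseteq\mathcal{R}(\mathbf{S})$, and the robust dynamic compliance satisfies $$\sup_{\mathbf{e}\in\mathbb{R}^q,\ \lVert\mathbf{e}\rVert_2\le1}\ \sup_{t\in\mathbb{R}}\ \mathbf{f}_{\mathrm R}(t,\mathbf{e})^{\mathsf T}\mathbf{u}(t,\mathbf{e})\le\overline{d}_{\mathrm R};$$ (2) $\begin{pmatrix}\overline{d}_{\mathrm R}\mathbf{I}_q & -\mathbf{Q}^{\mathsf T}\\ -\mathbf{Q} & \mathbf{K}(\mathbf{a})-\omega^2\mathbf{M}(\mathbf{a})\end{pmatrix}\succeq\mathbf{0}$.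
   Context: For $\mathbf{a}\in\mathbb{R}^{n_{\mathrm e}}_{\ge 0}$ the stiffness and mass matrices are $\mathbf{K}(\mathbf{a})=\sum_{e=1}^{n_{\mathrm e}}\big[a_e\mathbf{K}^{(1)}_e+a_e^2\mathbf{K}^{(2)}_e+a_e^3\mathbf{K}^{(3)}_e\big]$ and $\mathbf{M}(\mathbf{a})=\mathbf{M}^{(0)}+\sum_{e=1}^{n_{\mathrm e}}a_e\mathbf{M}^{(1)}_e$, where all $\mathbf{K}^{(i)}_e$, $\mathbf{M}^{(0)}$, $\mathbf{M}^{(1)}_e$ are fixed real symmetric positive semidefinite $n_{\mathrm{dof}}\times n_{\mathrm{dof}}$ matrices. The uncertain harmonic load is $\mathbf{f}_{\mathrm R}(t,\mathbf{e})=\big(c_1\cos(\omega t)+c_2\sin(\omega t)\big)\mathbf{Q}\mathbf{e}$. When $\mathbf{Q}\mathbf{e}\in\mathcal{R}(\mathbf{S})$, the harmonic displacement response of $\mathbf{K}(\mathbf{a})\mathbf{u}+\mathbf{M}(\mathbf{a})\mathbf{u}''=\mathbf{f}_{\mathrm R}$ is taken to be $\mathbf{u}(t,\mathbf{e})=\big(c_1\cos(\omega t)+c_2\sin(\omega t)\big)\mathbf{S}^{\dagger}\mathbf{Q}\mathbf{e}$. $\mathbf{A}\succeq\mathbf{0}$ means that the real symmetric matrix $\mathbf{A}$ is positive semidefinite, $\mathcal{R}(\cdot)$ is the range (column space), $(\cdot)^{\dagger}$ the Moore-Penrose pseudoinverse, $\mathbf{I}_q$ the $q\times q$ identity. *)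

theory Defs
  imports "HOL-Analysis.Analysis"
begin

definition psd_matrix :: "real^'n^'n \<Rightarrow> bool" where
  "psd_matrix A \<longleftrightarrow> transpose A = A \<and> (\<forall>x. 0 \<le> x \<bullet> (A *v x))"

definition mat_range :: "real^'n^'m \<Rightarrow> (real^'m) set" where
  "mat_range A = range (\<lambda>x. A *v x)"

text \<open>The four Penrose conditions; over the reals the adjoint is the transpose.\<close>

definition is_pseudoinverse :: "real^'n^'m \<Rightarrow> real^'m^'n \<Rightarrow> bool" where
  "is_pseudoinverse A X \<longleftrightarrow>
     A ** X ** A = A \<and> X ** A ** X = X \<and>
     transpose (A ** X) = A ** X \<and> transpose (X ** A) = X ** A"

definition pseudoinverse :: "real^'n^'m \<Rightarrow> real^'m^'n" where
  "pseudoinverse A = (THE X. is_pseudoinverse A X)"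

definition block_matrix ::
  "real^'q^'p \<Rightarrow> real^'n^'p \<Rightarrow> real^'q^'m \<Rightarrow> real^'n^'m \<Rightarrow> real^('q + 'n)^('p + 'm)" where
  "block_matrix A B C D =
     (\<chi> i j. case i of
         Inl i' \<Rightarrow> (case j of Inl j' \<Rightarrow> A $ i' $ j' | Inr j' \<Rightarrow> B $ i' $ j')
       | Inr i' \<Rightarrow> (case j of Inl j' \<Rightarrow> C $ i' $ j' | Inr j' \<Rightarrow> D $ i' $ j'))"

definition stiffness ::
  "('e::finite \<Rightarrow> real^'n^'n) \<Rightarrow> ('e \<Rightarrow> real^'n^'n) \<Rightarrow> ('e \<Rightarrow> real^'n^'n) \<Rightarrow> real^'e \<Rightarrow> real^'n^'n" where
  "stiffness K1 K2 K3 a =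
     (\<Sum>e\<in>UNIV. (a $ e) *\<^sub>R K1 e + (a $ e)\<^sup>2 *\<^sub>R K2 e + (a $ e) ^ 3 *\<^sub>R K3 e)"

definition mass ::
  "real^'n^'n \<Rightarrow> ('e::finite \<Rightarrow> real^'n^'n) \<Rightarrow> real^'e \<Rightarrow> real^'n^'n" where
  "mass M0 M1 a = M0 + (\<Sum>e\<in>UNIV. (a $ e) *\<^sub>R M1 e)"

definition harmonic_load ::
  "real \<Rightarrow> real \<Rightarrow> real \<Rightarrow> real^'q^'n \<Rightarrow> real \<Rightarrow> real^'q \<Rightarrow> real^'n" where
  "harmonic_load c1 c2 \<omega> Q t e = (c1 * cos (\<omega> * t) + c2 * sin (\<omega> * t)) *\<^sub>R (Q *v e)"

text \<open>Meaningful as a response to the load only if \<open>Q *v e \<in> mat_range S\<close>, where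
  \<open>S\<close> is the dynamic stiffness matrix.\<close>

definition harmonic_response ::
  "real \<Rightarrow> real \<Rightarrow> real \<Rightarrow> real^'q^'n \<Rightarrow> real^'n^'n \<Rightarrow> real \<Rightarrow> real^'q \<Rightarrow> real^'n" where
  "harmonic_response c1 c2 \<omega> Q S t e =
     (c1 * cos (\<omega> * t) + c2 * sin (\<omega> * t)) *\<^sub>R (pseudoinverse S *v (Q *v e))"

text \<open>The suprema are taken in the extended reals, so that no boundedness is presupposed.\<close>

definition robust_dynamic_compliance ::
  "real \<Rightarrow> real \<Rightarrow> real \<Rightarrow> real^'q^'n \<Rightarrow> real^'n^'n \<Rightarrow> ereal" where
  "robust_dynamic_compliance c1 c2 \<omega> Q S =
     (SUP e\<in>{e. norm e \<le> 1}. SUP t\<in>(UNIV::real set).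
        ereal (harmonic_load c1 c2 \<omega> Q t e \<bullet> harmonic_response c1 c2 \<omega> Q S t e))"

lemma is_pseudoinverse_unique:
  assumes X: "is_pseudoinverse A X" and Y: "is_pseudoinverse A Y"
  shows "X = Y"
proof -
  note x = X[unfolded is_pseudoinverse_def] and y = Y[unfolded is_pseudoinverse_def]
  have "A ** X = (A ** Y ** A) ** X"
    using y by simp
  also have "\<dots> = transpose (A ** Y) ** transpose (A ** X)"
    using x y by (simp add: matrix_mul_assoc)
  also have "\<dots> = transpose (A ** X ** (A ** Y))"
    by (simp add: matrix_transpose_mul)
  also have "\<dots> = A ** Y"
    using x y by (simp add: matrix_mul_assoc)
  finally have 1: "A ** X = A ** Y" .
  have "X ** A = X ** (A ** Y ** A)"
    using y by simp
  also have "\<dots> = transpose (X ** A) ** transpose (Y ** A)"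
    using x y by (simp flip: matrix_mul_assoc)
  also have "\<dots> = transpose (Y ** A ** (X ** A))"
    by (simp add: matrix_transpose_mul)
  also have "Y ** A ** (X ** A) = Y ** (A ** X ** A)"
    by (simp add: matrix_mul_assoc)
  also have "transpose \<dots> = Y ** A"
    using x y by simp
  finally have 2: "X ** A = Y ** A" .
  have "X = X ** A ** X" using x by simp
  also have "\<dots> = Y ** (A ** X)" using 2 by (simp add: matrix_mul_assoc)
  also have "\<dots> = Y ** A ** Y" using 1 by (simp add: matrix_mul_assoc)
  finally show ?thesis using y by simp
qed

lemma gram_cancel:
  fixes A :: "real^'n^'m" and B C :: "real^'k^'n"
  assumes "transpose A ** A ** B = transpose A ** A ** C"
  shows "A ** B = A ** C"
proof -
  have "A *v (B *v x) = A *v (C *v x)" for x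
  proof -
    let ?d = "B *v x - C *v x"
    have "transpose A *v (A *v ?d) = 0"
      using arg_cong[OF assms, of "\<lambda>M. M *v x"]
      by (simp add: matrix_vector_mul_assoc matrix_vector_mult_diff_distrib matrix_mul_assoc)
    then have "(A *v ?d) \<bullet> (A *v ?d) = 0"
      by (metis dot_lmul_matrix inner_zero_left transpose_matrix_vector)
    then have "A *v ?d = 0" by simp
    then show ?thesis
      by (simp add: matrix_vector_mult_diff_distrib)
  qed
  then show ?thesis
    by (simp add: matrix_eq matrix_vector_mul_assoc)
qed

lemma inner_inverse_exists:
  fixes A :: "real^'n^'m"
  shows "\<exists>G. A ** G ** A = A"
proof -
  obtain g where g: "linear g" "\<forall>v\<in>range ((*v) A). A *v g v = v"
    using real_vector.linear_exists_right_inverse_on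
      [OF matrix_vector_mul_linear[of A] real_vector.subspace_UNIV] by blast
  then have "A ** matrix g ** A = A"
    by (simp add: matrix_eq matrix_works flip: matrix_vector_mul_assoc)
  then show ?thesis by blast
qed

lemma gram_inner_inverse:
  fixes A :: "real^'n^'m"
  obtains X where "A ** X ** A = A" "transpose (A ** X) = A ** X"
proof -
  obtain G where G: "transpose A ** A ** G ** (transpose A ** A) = transpose A ** A"
    using inner_inverse_exists by blast
  have 1: "A ** G ** transpose A ** A = A"
    using gram_cancel[of A "G ** (transpose A ** A)" "mat 1"] G
    by (simp add: matrix_mul_assoc)
  have 2: "transpose A ** A ** transpose G ** transpose A = transpose A"
    using arg_cong[OF 1, of transpose] by (simp add: matrix_transpose_mul matrix_mul_assoc)
  have "A ** G ** transpose A = A ** G ** (transpose A ** A ** transpose G ** transpose A)"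
    using 2 by simp
  also have "\<dots> = (A ** G ** transpose A ** A) ** transpose G ** transpose A"
    by (simp add: matrix_mul_assoc)
  also have "\<dots> = transpose (A ** G ** transpose A)"
    using 1 by (simp add: matrix_transpose_mul matrix_mul_assoc)
  finally show ?thesis
    using that[of "G ** transpose A"] 1 by (simp add: matrix_mul_assoc)
qed

lemma is_pseudoinverse_exists:
  fixes A :: "real^'n^'m"
  shows "\<exists>X. is_pseudoinverse A X"
proof -
  obtain X where X: "A ** X ** A = A" "transpose (A ** X) = A ** X"
    by (rule gram_inner_inverse)
  obtain Z where Z: "transpose A ** Z ** transpose A = transpose A"
    "transpose (transpose A ** Z) = transpose A ** Z"
    by (rule gram_inner_inverse)
  define Y where "Y = transpose Z"
  have Y: "A ** Y ** A = A" "transpose (Y ** A) = Y ** A"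
    using arg_cong[OF Z(1), of transpose] Z(2)
    by (simp_all add: Y_def matrix_transpose_mul matrix_mul_assoc)
  have a: "A ** (Y ** A ** X) = A ** X" and b: "Y ** A ** X ** A = Y ** A"
    using Y(1) X(1) by (simp_all add: matrix_mul_assoc) (metis matrix_mul_assoc)
  have "is_pseudoinverse A (Y ** A ** X)"
    unfolding is_pseudoinverse_def a b
    using X Y by (metis matrix_mul_assoc)
  then show ?thesis by blast
qed

lemma is_pseudoinverse_pseudoinverse: "is_pseudoinverse A (pseudoinverse A)"
  unfolding pseudoinverse_def
  by (rule theI') (use is_pseudoinverse_exists is_pseudoinverse_unique in blast)

end

theory Submission
  imports Defs
begin

text \<open>
  The theorem is a Schur complement criterion. Write \<open>X\<close> for the pseudoinverse of \<open>S\<close>. The load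
  and the response carry the same time factor, whose square has maximum \<open>c1\<^sup>2 + c2\<^sup>2 = 1\<close>. So for
  positive semidefinite \<open>S\<close> whose range contains that of \<open>Q\<close>, the compliance bound says that
  \<open>(Q *v e) \<bullet> (X *v (Q *v e)) \<le> d\<close> for all \<open>e\<close> in the unit ball. The left side is quadratic
  in \<open>e\<close>, so scaling turns this into a bound by \<open>d * (e \<bullet> e)\<close> for all \<open>e\<close>, which is positive
  semidefiniteness of \<open>d *\<^sub>R mat 1 - transpose Q ** X ** Q\<close> (lemma
  \<open>robust_dynamic_compliance_le_iff\<close>). That matrix is the generalized Schur complement of \<open>S\<close>
  in the block matrix.

  The generalized Schur criterion (lemma \<open>psd_block_matrix_iff_schur\<close>) rests on completing the
  square: if the off-diagonal block maps into the range of \<open>S\<close>, the quadratic form of the block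
  matrix splits into that of \<open>S\<close> at a shifted vector and that of the Schur complement. The range
  condition is forced by positivity: in a direction from the kernel of \<open>S\<close> the form has no
  quadratic term, so its linear term, the pairing with the off-diagonal block, has to vanish. Hence
  the off-diagonal block maps into the orthogonal complement of the kernel, which is the range of
  the symmetric matrix \<open>S\<close>.
\<close>

section \<open>Quadratic forms of matrices\<close>

lemma inner_matrix_transpose:
  fixes A :: "real^'n^'m"
  shows "x \<bullet> (A *v y) = (transpose A *v x) \<bullet> y"
  by (simp add: dot_lmul_matrix)

lemma matrix_vector_mult_minus_left:
  fixes A :: "real^'n^'m"
  shows "(- A) *v x = - (A *v x)"
  using matrix_vector_mult_diff_rdistrib[of 0 A x] by simp

lemma matrix_vector_mult_minus_right:
  fixes A :: "real^'n^'m"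
  shows "A *v (- x) = - (A *v x)"
  using matrix_vector_mult_diff_distrib[of A 0 x] by simp

lemma symmetric_matrix_inner_commute:
  fixes A :: "real^'n^'n"
  assumes "transpose A = A"
  shows "x \<bullet> (A *v y) = y \<bullet> (A *v x)"
  using inner_matrix_transpose[of x A y] assms by (simp add: inner_commute)

lemma affine_nonneg_imp_slope_zero:
  fixes a b :: real
  assumes "\<And>s. 0 \<le> a + s * b"
  shows "b = 0"
proof (rule ccontr)
  assume "b \<noteq> 0"
  then have "a + (- (a + 1) / b) * b = - 1" by simp
  with assms[of "- (a + 1) / b"] show False by simp
qed

section \<open>Block matrices\<close>

definition join_vec :: "real^'q \<Rightarrow> real^'n \<Rightarrow> real^('q + 'n)" where
  "join_vec x y = (\<chi> i. case i of Inl j \<Rightarrow> x $ j | Inr j \<Rightarrow> y $ j)"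

lemma join_vec_exhaust: "\<exists>x y. z = join_vec x y"
  by (rule exI[of _ "\<chi> j. z $ Inl j"], rule exI[of _ "\<chi> j. z $ Inr j"])
     (auto simp: join_vec_def vec_eq_iff split: sum.split)

lemma sum_UNIV_sum_type:
  fixes f :: "'a::finite + 'b::finite \<Rightarrow> real"
  shows "sum f UNIV = (\<Sum>i\<in>UNIV. f (Inl i)) + (\<Sum>i\<in>UNIV. f (Inr i))"
  by (simp add: sum.Plus flip: UNIV_Plus_UNIV)

lemma inner_join_vec: "join_vec x y \<bullet> join_vec x' y' = x \<bullet> x' + y \<bullet> y'"
  by (simp add: inner_vec_def join_vec_def sum_UNIV_sum_type)

lemma block_matrix_mult_join_vec:
  "block_matrix A B C D *v join_vec x y = join_vec (A *v x + B *v y) (C *v x + D *v y)"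
  by (auto simp: vec_eq_iff matrix_vector_mult_def block_matrix_def join_vec_def
        sum_UNIV_sum_type split: sum.split)

lemma transpose_block_matrix:
  "transpose (block_matrix A B C D) =
     block_matrix (transpose A) (transpose C) (transpose B) (transpose D)"
  by (auto simp: vec_eq_iff transpose_def block_matrix_def split: sum.split)

lemma block_matrix_eq_iff:
  "block_matrix A B C D = block_matrix A' B' C' D' \<longleftrightarrow> A = A' \<and> B = B' \<and> C = C' \<and> D = D'"
  by (auto simp: vec_eq_iff block_matrix_def split: sum.split_asm sum.split)

lemma psd_block_matrix_iff_form:
  fixes A :: "real^'q^'q" and B :: "real^'n^'q" and D :: "real^'n^'n"
  shows "psd_matrix (block_matrix A B (transpose B) D) \<longleftrightarrow>
     transpose A = A \<and> transpose D = D \<and>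
     (\<forall>x y. 0 \<le> x \<bullet> (A *v x) + 2 * (y \<bullet> (transpose B *v x)) + y \<bullet> (D *v y))"
proof -
  let ?M = "block_matrix A B (transpose B) D"
  have "join_vec x y \<bullet> (?M *v join_vec x y) =
      x \<bullet> (A *v x) + 2 * (y \<bullet> (transpose B *v x)) + y \<bullet> (D *v y)" for x y
    using inner_matrix_transpose[of x B y]
    by (simp add: block_matrix_mult_join_vec inner_join_vec inner_add_right inner_commute)
  then have "(\<forall>z. 0 \<le> z \<bullet> (?M *v z)) \<longleftrightarrow>
      (\<forall>x y. 0 \<le> x \<bullet> (A *v x) + 2 * (y \<bullet> (transpose B *v x)) + y \<bullet> (D *v y))"
    by (metis join_vec_exhaust)
  then show ?thesis
    by (auto simp: psd_matrix_def transpose_block_matrix block_matrix_eq_iff)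
qed

section \<open>Pseudoinverses of symmetric matrices\<close>

text \<open>The Penrose conditions are invariant under transposing both matrices and exchanging the
  roles of the two products.\<close>

lemma pseudoinverse_symmetric:
  fixes S :: "real^'n^'n"
  assumes "transpose S = S"
  shows "transpose (pseudoinverse S) = pseudoinverse S"
proof -
  let ?X = "pseudoinverse S"
  note X = is_pseudoinverse_pseudoinverse[of S, unfolded is_pseudoinverse_def]
  have sx: "S ** transpose ?X = ?X ** S" and xs: "transpose ?X ** S = S ** ?X"
    using X assms by (metis matrix_transpose_mul)+
  have "is_pseudoinverse S (transpose ?X)"
    unfolding is_pseudoinverse_def sx xs
    using X assms sx xs by (metis matrix_transpose_mul matrix_mul_assoc)
  then show ?thesis
    using is_pseudoinverse_unique is_pseudoinverse_pseudoinverse by blast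
qed

lemma mult_pseudoinverse_of_range:
  assumes "w \<in> mat_range S"
  shows "S *v (pseudoinverse S *v w) = w"
  using assms is_pseudoinverse_pseudoinverse[of S, unfolded is_pseudoinverse_def]
  by (auto simp: mat_range_def matrix_vector_mul_assoc matrix_mul_assoc)

text \<open>For symmetric \<open>S\<close> the range is the orthogonal complement of the kernel. The proof takes
  the residual of \<open>w\<close> under the projection \<open>S ** pseudoinverse S\<close>: it lies in the kernel and is
  orthogonal to the range, hence orthogonal to itself.\<close>

lemma mem_range_symmetric_if_orthogonal_kernel:
  fixes S :: "real^'n^'n"
  assumes sym: "transpose S = S" and orth: "\<And>v. S *v v = 0 \<Longrightarrow> v \<bullet> w = 0"
  shows "w \<in> mat_range S"
proof -
  let ?X = "pseudoinverse S"
  let ?r = "w - S *v (?X *v w)"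
  note X = is_pseudoinverse_pseudoinverse[of S, unfolded is_pseudoinverse_def]
  have "S ** (S ** ?X) = S"
    using X sym by (metis matrix_transpose_mul)
  then have ker: "S *v ?r = 0"
    by (simp add: matrix_vector_mult_diff_distrib matrix_vector_mul_assoc matrix_mul_assoc)
  have "?r \<bullet> (S *v (?X *v w)) = 0"
    using inner_matrix_transpose[of ?r S "?X *v w"] sym ker by simp
  with orth[OF ker] have "?r \<bullet> ?r = 0"
    by (simp only: inner_diff_right)
  then have "w = S *v (?X *v w)" by simp
  then show ?thesis by (auto simp: mat_range_def)
qed

section \<open>The generalized Schur complement\<close>

text \<open>The form of the block matrix at \<open>(x, y)\<close> is the form of \<open>D\<close> at the shifted vector
  \<open>y + pseudoinverse D *v (transpose B *v x)\<close> plus the form of the Schur complement at \<open>x\<close>, as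
  soon as \<open>D\<close> undoes the pseudoinverse on \<open>transpose B *v x\<close>. That is where the range condition
  is used.\<close>

lemma psd_block_matrix_iff_schur:
  fixes A :: "real^'q^'q" and B :: "real^'n^'q" and D :: "real^'n^'n"
  assumes symA: "transpose A = A"
  shows "psd_matrix (block_matrix A B (transpose B) D) \<longleftrightarrow>
     psd_matrix D \<and> mat_range (transpose B) \<subseteq> mat_range D \<and>
     psd_matrix (A - B ** pseudoinverse D ** transpose B)"
    (is "?block \<longleftrightarrow> ?schur")
proof -
  let ?X = "pseudoinverse D"
  let ?C = "A - B ** ?X ** transpose B"
  let ?w = "\<lambda>x. transpose B *v x"
  let ?form = "\<lambda>x y. x \<bullet> (A *v x) + 2 * (y \<bullet> ?w x) + y \<bullet> (D *v y)"
  have C_form: "x \<bullet> (?C *v x) = x \<bullet> (A *v x) - ?w x \<bullet> (?X *v ?w x)" for x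
    by (simp add: matrix_vector_mult_diff_rdistrib inner_diff_right inner_matrix_transpose[of x B]
        flip: matrix_vector_mul_assoc)
  have square: "?form x y = (y + ?X *v ?w x) \<bullet> (D *v (y + ?X *v ?w x)) + x \<bullet> (?C *v x)"
    if symD: "transpose D = D" and range: "mat_range (transpose B) \<subseteq> mat_range D" for x y
  proof -
    have u: "D *v (?X *v ?w x) = ?w x"
      using range by (intro mult_pseudoinverse_of_range) (auto simp: mat_range_def)
    then show ?thesis
      using symmetric_matrix_inner_commute[OF symD, of "?X *v ?w x" y]
      by (simp add: C_form matrix_vector_right_distrib inner_add_left inner_add_right inner_commute)
  qed
  show ?thesis
  proof
    assume ?block
    then have symD: "transpose D = D" and form: "\<And>x y. 0 \<le> ?form x y"
      by (auto simp: psd_block_matrix_iff_form)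
    have psdD: "psd_matrix D"
      using symD form[of 0] by (auto simp: psd_matrix_def)
    have "y \<bullet> ?w x = 0" if "D *v y = 0" for x y
    proof -
      have "0 \<le> x \<bullet> (A *v x) + s * (2 * (y \<bullet> ?w x))" for s
        using form[of x "s *\<^sub>R y"] that
        by (simp add: matrix_vector_mult_scaleR algebra_simps)
      then show ?thesis
        using affine_nonneg_imp_slope_zero by fastforce
    qed
    then have range: "mat_range (transpose B) \<subseteq> mat_range D"
      using mem_range_symmetric_if_orthogonal_kernel[OF symD]
      by (auto simp: mat_range_def[of "transpose B"])
    \<comment> \<open>The shift makes the square vanish: it minimizes the form over the second block.\<close>
    have "0 \<le> x \<bullet> (?C *v x)" for x
      using form[of x "- (?X *v ?w x)"] square[OF symD range, of x "- (?X *v ?w x)"] by simp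
    moreover have "transpose ?C = ?C"
    proof -
      have "transpose (B ** ?X ** transpose B) = B ** ?X ** transpose B"
        using pseudoinverse_symmetric[OF symD] by (simp add: matrix_transpose_mul matrix_mul_assoc)
      then show ?thesis using symA by (simp add: transpose_def vec_eq_iff)
    qed
    ultimately show ?schur
      using psdD range by (auto simp: psd_matrix_def)
  next
    assume schur: ?schur
    then have symD: "transpose D = D" and range: "mat_range (transpose B) \<subseteq> mat_range D"
      and D: "\<And>y. 0 \<le> y \<bullet> (D *v y)" and C: "\<And>x. 0 \<le> x \<bullet> (?C *v x)"
      unfolding psd_matrix_def by blast+
    have "0 \<le> ?form x y" for x y
      unfolding square[OF symD range] by (intro add_nonneg_nonneg D C)
    then show ?block
      unfolding psd_block_matrix_iff_form using symA symD by blast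
  qed
qed

section \<open>The robust dynamic compliance\<close>

text \<open>The left side squares the inner product of two unit vectors; the other square in the proof
  is that of their determinant, and both add up to the product of the squared lengths.\<close>

lemma harmonic_factor_sq_le:
  fixes c1 c2 :: real
  assumes "c1\<^sup>2 + c2\<^sup>2 = 1"
  shows "(c1 * cos x + c2 * sin x)\<^sup>2 \<le> 1"
proof -
  have "(c1 * cos x + c2 * sin x)\<^sup>2 + (c1 * sin x - c2 * cos x)\<^sup>2
      = (c1\<^sup>2 + c2\<^sup>2) * ((sin x)\<^sup>2 + (cos x)\<^sup>2)"
    by algebra
  also have "\<dots> = 1" using assms by simp
  finally show ?thesis
    using zero_le_power2[of "c1 * sin x - c2 * cos x"] by linarith
qed

lemma harmonic_factor_attains_one:
  fixes c1 c2 \<omega> :: real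
  assumes "c1\<^sup>2 + c2\<^sup>2 = 1" "\<omega> \<noteq> 0"
  obtains t where "(c1 * cos (\<omega> * t) + c2 * sin (\<omega> * t))\<^sup>2 = 1"
proof -
  obtain x where "c1 = cos x" "c2 = sin x"
    using sincos_total_2pi[OF assms(1)] by metis
  then have "(c1 * cos (\<omega> * (x / \<omega>)) + c2 * sin (\<omega> * (x / \<omega>)))\<^sup>2 = 1"
    using assms(2) by (simp flip: power2_eq_square)
  then show ?thesis by (rule that)
qed

text \<open>Positivity of \<open>S\<close> enters through the sign of
  \<open>(Q *v e) \<bullet> (pseudoinverse S *v (Q *v e))\<close>: because it is nonnegative, a time of
  largest amplitude is a worst one.\<close>

lemma robust_dynamic_compliance_le_iff:
  fixes S :: "real^'n^'n" and Q :: "real^'q^'n" and \<omega> d c1 c2 :: real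
  assumes psd: "psd_matrix S" and range: "mat_range Q \<subseteq> mat_range S"
    and c: "c1\<^sup>2 + c2\<^sup>2 = 1" and \<omega>: "\<omega> \<noteq> 0"
  shows "robust_dynamic_compliance c1 c2 \<omega> Q S \<le> ereal d \<longleftrightarrow>
     psd_matrix (d *\<^sub>R mat 1 - transpose Q ** pseudoinverse S ** Q)"
proof -
  let ?X = "pseudoinverse S"
  let ?k = "\<lambda>e. (Q *v e) \<bullet> (?X *v (Q *v e))"
  let ?p = "\<lambda>t. c1 * cos (\<omega> * t) + c2 * sin (\<omega> * t)"
  let ?C = "d *\<^sub>R mat 1 - transpose Q ** ?X ** Q"
  have k_nonneg: "0 \<le> ?k e" for e
  proof -
    have "S *v (?X *v (Q *v e)) = Q *v e"
      using range by (intro mult_pseudoinverse_of_range) (auto simp: mat_range_def)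
    then show ?thesis
      using psd unfolding psd_matrix_def by (metis inner_commute)
  qed
  have "robust_dynamic_compliance c1 c2 \<omega> Q S \<le> ereal d \<longleftrightarrow>
      (\<forall>e. norm e \<le> 1 \<longrightarrow> (\<forall>t. (?p t)\<^sup>2 * ?k e \<le> d))"
    by (simp add: robust_dynamic_compliance_def SUP_le_iff harmonic_load_def harmonic_response_def
        power2_eq_square mult.assoc)
  also have "\<dots> \<longleftrightarrow> (\<forall>e. norm e \<le> 1 \<longrightarrow> ?k e \<le> d)"
  proof -
    obtain t where t: "(?p t)\<^sup>2 = 1"
      using harmonic_factor_attains_one[OF c \<omega>] .
    have le: "(?p s)\<^sup>2 * ?k e \<le> ?k e" for s e
      using mult_right_mono[OF harmonic_factor_sq_le[OF c, of "\<omega> * s"] k_nonneg[of e]] by simp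
    show ?thesis
    proof (intro iffI allI impI)
      fix e :: "real^'q"
      assume "\<forall>e. norm e \<le> 1 \<longrightarrow> (\<forall>t. (?p t)\<^sup>2 * ?k e \<le> d)" and "norm e \<le> 1"
      then have "(?p t)\<^sup>2 * ?k e \<le> d" by blast
      then show "?k e \<le> d" using t by simp
    next
      fix e :: "real^'q" and s
      assume "\<forall>e. norm e \<le> 1 \<longrightarrow> ?k e \<le> d" and "norm e \<le> 1"
      then have "?k e \<le> d" by blast
      with le[of s e] show "(?p s)\<^sup>2 * ?k e \<le> d" by (rule order_trans)
    qed
  qed
  also have "\<dots> \<longleftrightarrow> (\<forall>e. ?k e \<le> d * (e \<bullet> e))"
  proof safe
    fix e :: "real^'q"
    assume ball: "\<forall>e. norm e \<le> 1 \<longrightarrow> ?k e \<le> d"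
    show "?k e \<le> d * (e \<bullet> e)"
    proof (cases "e = 0")
      case False
      have "?k e = (norm e)\<^sup>2 * ?k ((1 / norm e) *\<^sub>R e)"
        using False by (simp add: matrix_vector_mult_scaleR power2_eq_square)
      also have "\<dots> \<le> (norm e)\<^sup>2 * d"
        using ball False by (intro mult_left_mono) auto
      finally show ?thesis
        by (simp add: power2_norm_eq_inner mult.commute)
    qed simp
  next
    fix e :: "real^'q"
    assume k: "\<forall>e. ?k e \<le> d * (e \<bullet> e)" and e: "norm e \<le> 1"
    show "?k e \<le> d"
    proof -
      \<comment> \<open>The sign of \<open>d\<close> comes from the bound itself, at any nonzero vector.\<close>
      have "0 \<le> d"
      proof -
        obtain b :: "real^'q" where "norm b = 1"
          using vector_choose_size[of 1] by auto
        then show ?thesis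
          using k[rule_format, of b] k_nonneg[of b] by (simp add: dot_square_norm)
      qed
      moreover have "e \<bullet> e \<le> 1"
        using e by (simp add: dot_square_norm power_le_one)
      ultimately have "d * (e \<bullet> e) \<le> d"
        by (simp add: mult_left_le)
      then show ?thesis using k order_trans by blast
    qed
  qed
  also have "\<dots> \<longleftrightarrow> psd_matrix ?C"
  proof -
    have "e \<bullet> (?C *v e) = d * (e \<bullet> e) - ?k e" for e
      using inner_matrix_transpose[of e "transpose Q" "?X *v (Q *v e)"]
      by (simp add: matrix_vector_mult_diff_rdistrib inner_diff_right
          flip: matrix_vector_mul_assoc scaleR_matrix_vector_assoc)
    moreover have "transpose ?C = ?C"
    proof -
      have "transpose (transpose Q ** ?X ** Q) = transpose Q ** ?X ** Q"
        using pseudoinverse_symmetric[of S] psd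
        by (simp add: psd_matrix_def matrix_transpose_mul matrix_mul_assoc)
      then show ?thesis
        by (auto simp: transpose_def vec_eq_iff mat_def)
    qed
    ultimately show ?thesis by (simp add: psd_matrix_def)
  qed
  finally show ?thesis .
qed

section \<open>Equivalence with the block matrix inequality\<close>

theorem mainTheorem6:
  fixes K1 K2 K3 :: "'e::finite \<Rightarrow> real^'n^'n"
    and M0 :: "real^'n^'n" and M1 :: "'e \<Rightarrow> real^'n^'n"
    and a :: "real^'e" and Q :: "real^'q^'n" and S :: "real^'n^'n"
    and \<omega> d c1 c2 :: real
  assumes "\<And>e. psd_matrix (K1 e)" and "\<And>e. psd_matrix (K2 e)" and "\<And>e. psd_matrix (K3 e)"
    and "psd_matrix M0" and "\<And>e. psd_matrix (M1 e)"
    and "\<And>e. 0 \<le> a $ e"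
    and "\<omega> > 0" and "d > 0" and "c1\<^sup>2 + c2\<^sup>2 = 1"
    and "S = stiffness K1 K2 K3 a - \<omega>\<^sup>2 *\<^sub>R mass M0 M1 a"
  shows "(psd_matrix S \<and> mat_range Q \<subseteq> mat_range S \<and>
            robust_dynamic_compliance c1 c2 \<omega> Q S \<le> ereal d)
         \<longleftrightarrow> psd_matrix (block_matrix (d *\<^sub>R mat 1) (- transpose Q)
               (- Q) (stiffness K1 K2 K3 a - \<omega>\<^sup>2 *\<^sub>R mass M0 M1 a))"
proof -
  have sym: "transpose (d *\<^sub>R mat 1) = (d *\<^sub>R mat 1 :: real^'q^'q)"
    by (auto simp: transpose_def vec_eq_iff mat_def)
  have neg: "transpose (- transpose Q) = - Q"
    by (simp add: transpose_def vec_eq_iff)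
  have range: "mat_range (- Q) = mat_range Q"
    unfolding mat_range_def image_def
    by (auto simp: matrix_vector_mult_minus_left) (metis matrix_vector_mult_minus_right minus_minus)+
  have prod: "- transpose Q ** pseudoinverse S ** - Q = transpose Q ** pseudoinverse S ** Q"
    by (simp add: matrix_eq matrix_vector_mult_minus_left matrix_vector_mult_minus_right
        flip: matrix_vector_mul_assoc)
  have "psd_matrix (block_matrix (d *\<^sub>R mat 1) (- transpose Q) (- Q) S) \<longleftrightarrow>
      psd_matrix S \<and> mat_range Q \<subseteq> mat_range S \<and>
      psd_matrix (d *\<^sub>R mat 1 - transpose Q ** pseudoinverse S ** Q)"
    using psd_block_matrix_iff_schur[OF sym, of "- transpose Q" S]
    by (simp only: neg range prod)
  then show ?thesis
    using robust_dynamic_compliance_le_iff[of S Q c1 c2 \<omega> d] assms by auto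
qed

end
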